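(* Let $(A,\ast,\odot)$ be a totally compatible dialgebra over $\mathbf{k}$. Define left and right actions of $(A,\ast)$ on $A$ by $$L_\ast(x):A\to A,\ L_\ast(x)(y):=x\ast y,\qquad R_\ast(x):A\to A,\ R_\ast(x)(y):=y\ast x,\qquad \forall x,y\in A.$$ Then the quadruple $(A,\odot,L_\ast,R_\ast)$ is an $A$-bimodule $\mathbf{k}$-algebra, where $A$ acts through the algebra $(A,\ast)$. Conversely, if $(A,\ast)$ is a $\mathbf{k}$-algebra and $(A,\odot,L_\ast,R_\ast)$ is an $A$-bimodule $\mathbf{k}$-algebra, with the left and right actions $L_\ast$ and $R_\ast$ defined by the formulas above, then the triple $(A,\ast,\odot)$ is a totally compatible dialgebra.
   Context: $\mathbf{k}$ is a commutative unitary ring; $\mathbf{k}$-algebras are associative and not assumed unitary. A totally compatible dialgebra is a $\mathbf{k}$-module $R$ with two bilinear binary operations $\ast,\odot$ that are both associative and satisfy $(a\ast b)\odot c=a\ast(b\odot c)=(a\odot b)\ast c=a\odot(b\ast c)$ for all $a,b,c\in R$. Let $(A,\ast)$ and $(R,\circ)$ be $\mathbf{k}$-algebras and let $\ell,r:A\to\mathrm{End}_{\mathbf{k}}(R)$ be linear maps, where $r(x)$ is written on the right: $v\,r(x)$ is the image of $v$ under $r(x)$. The quadruple $(R,\circ,\ell,r)$ is an $A$-bimodule $\mathbf{k}$-algebra if for all $x,y\in A$ and $v,w\in R$: $\ell(x\ast y)v=\ell(x)(\ell(y)v)$, $\ v\,r(x\ast y)=(v\,r(x))r(y)$, $\ (\ell(x)v)r(y)=\ell(x)(v\,r(y))$,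 $\ell(x)(v\circ w)=(\ell(x)v)\circ w$, $\ (v\circ w)r(x)=v\circ(w\,r(x))$, $\ (v\,r(x))\circ w=v\circ(\ell(x)w)$. *)

theory Defs
  imports "HOL-Algebra.Module"
begin

text \<open>
  Algebras here are associative but not assumed commutative or unital, so the library's
  \<open>algebra\<close> locale does not apply. A product is a separate binary operation on the
  carrier of a module, so that one module can carry several products. The multiplicative fields of
  the module record play no role: \<^locale>\<open>module\<close> imposes nothing on them.
\<close>

definition module_hom :: "('k, 'c) ring_scheme \<Rightarrow> ('k, 'a, 'd) module_scheme
    \<Rightarrow> ('k, 'b, 'e) module_scheme \<Rightarrow> ('a \<Rightarrow> 'b) set" where
  "module_hom K M N = {f \<in> carrier M \<rightarrow> carrier N.
     (\<forall>x \<in> carrier M. \<forall>y \<in> carrier M. f (x \<oplus>\<^bsub>M\<^esub> y) = f x \<oplus>\<^bsub>N\<^esub> f y) \<and>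
     (\<forall>c \<in> carrier K. \<forall>x \<in> carrier M. f (c \<odot>\<^bsub>M\<^esub> x) = c \<odot>\<^bsub>N\<^esub> f x)}"

abbreviation module_End :: "('k, 'c) ring_scheme \<Rightarrow> ('k, 'a, 'd) module_scheme \<Rightarrow> ('a \<Rightarrow> 'a) set" where
  "module_End K M \<equiv> module_hom K M M"

definition bilinear_op :: "('k, 'c) ring_scheme \<Rightarrow> ('k, 'a, 'd) module_scheme
    \<Rightarrow> ('a \<Rightarrow> 'a \<Rightarrow> 'a) \<Rightarrow> bool" where
  "bilinear_op K M f \<longleftrightarrow>
     (\<forall>x \<in> carrier M. f x \<in> module_End K M) \<and>
     (\<forall>y \<in> carrier M. (\<lambda>x. f x y) \<in> module_End K M)"

text \<open>
  A linear map from \<open>A\<close> to the module of endomorphisms of \<open>R\<close>. Endomorphisms are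
  functions on the whole type of which only the values on the carrier matter, so the pointwise
  equations defining linearity are required on the carrier of \<open>R\<close> only.
\<close>

definition linear_to_End :: "('k, 'c) ring_scheme \<Rightarrow> ('k, 'a, 'd) module_scheme
    \<Rightarrow> ('k, 'r, 'e) module_scheme \<Rightarrow> ('a \<Rightarrow> 'r \<Rightarrow> 'r) \<Rightarrow> bool" where
  "linear_to_End K A R f \<longleftrightarrow>
     f \<in> carrier A \<rightarrow> module_End K R \<and>
     (\<forall>x \<in> carrier A. \<forall>y \<in> carrier A. \<forall>v \<in> carrier R. f (x \<oplus>\<^bsub>A\<^esub> y) v = f x v \<oplus>\<^bsub>R\<^esub> f y v) \<and>
     (\<forall>c \<in> carrier K. \<forall>x \<in> carrier A. \<forall>v \<in> carrier R. f (c \<odot>\<^bsub>A\<^esub> x) v = c \<odot>\<^bsub>R\<^esub> f x v)"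

locale assoc_algebra = module K A
  for K :: "('k, 'c) ring_scheme" and A :: "('k, 'a, 'd) module_scheme" +
  fixes mul :: "'a \<Rightarrow> 'a \<Rightarrow> 'a" (infixl \<open>\<ast>\<close> 70)
  assumes bilinear: "bilinear_op K A mul"
    and assoc: "\<lbrakk>x \<in> carrier A; y \<in> carrier A; z \<in> carrier A\<rbrakk> \<Longrightarrow> (x \<ast> y) \<ast> z = x \<ast> (y \<ast> z)"

locale totally_compatible_dialgebra =
  ast: assoc_algebra K A ast + odot: assoc_algebra K A odot
  for K :: "('k, 'c) ring_scheme" and A :: "('k, 'a, 'd) module_scheme"
    and ast :: "'a \<Rightarrow> 'a \<Rightarrow> 'a" (infixl \<open>\<ast>\<close> 70)
    and odot :: "'a \<Rightarrow> 'a \<Rightarrow> 'a" (infixl \<open>\<diamondop>\<close> 70) +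
  assumes compat1: "\<lbrakk>a \<in> carrier A; b \<in> carrier A; c \<in> carrier A\<rbrakk>
      \<Longrightarrow> (a \<ast> b) \<diamondop> c = a \<ast> (b \<diamondop> c)"
    and compat2: "\<lbrakk>a \<in> carrier A; b \<in> carrier A; c \<in> carrier A\<rbrakk>
      \<Longrightarrow> a \<ast> (b \<diamondop> c) = (a \<diamondop> b) \<ast> c"
    and compat3: "\<lbrakk>a \<in> carrier A; b \<in> carrier A; c \<in> carrier A\<rbrakk>
      \<Longrightarrow> (a \<diamondop> b) \<ast> c = a \<diamondop> (b \<ast> c)"

text \<open>
  In \<open>bimodule_algebra K A ast R circ l r\<close> the algebra \<open>(A, ast)\<close> acts on the algebra
  \<open>(R, circ)\<close>, and \<open>r x v\<close> is the image of \<open>v\<close> under \<open>r x\<close>, usually written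
  \<open>v r(x)\<close> with the operator on the right.
\<close>

locale bimodule_algebra =
  A: assoc_algebra K A ast + R: assoc_algebra K R circ
  for K :: "('k, 'c) ring_scheme"
    and A :: "('k, 'a, 'd) module_scheme" and ast :: "'a \<Rightarrow> 'a \<Rightarrow> 'a" (infixl \<open>\<ast>\<close> 70)
    and R :: "('k, 'r, 'e) module_scheme" and circ :: "'r \<Rightarrow> 'r \<Rightarrow> 'r" (infixl \<open>\<diamondop>\<close> 70) +
  fixes l r :: "'a \<Rightarrow> 'r \<Rightarrow> 'r"
  assumes l_linear: "linear_to_End K A R l"
    and r_linear: "linear_to_End K A R r"
    and l_mult: "\<lbrakk>x \<in> carrier A; y \<in> carrier A; v \<in> carrier R\<rbrakk> \<Longrightarrow> l (x \<ast> y) v = l x (l y v)"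
    and r_mult: "\<lbrakk>x \<in> carrier A; y \<in> carrier A; v \<in> carrier R\<rbrakk> \<Longrightarrow> r (x \<ast> y) v = r y (r x v)"
    and l_r_commute: "\<lbrakk>x \<in> carrier A; y \<in> carrier A; v \<in> carrier R\<rbrakk> \<Longrightarrow> r y (l x v) = l x (r y v)"
    and l_circ: "\<lbrakk>x \<in> carrier A; v \<in> carrier R; w \<in> carrier R\<rbrakk> \<Longrightarrow> l x (v \<diamondop> w) = l x v \<diamondop> w"
    and r_circ: "\<lbrakk>x \<in> carrier A; v \<in> carrier R; w \<in> carrier R\<rbrakk> \<Longrightarrow> r x (v \<diamondop> w) = v \<diamondop> r x w"
    and r_circ_l: "\<lbrakk>x \<in> carrier A; v \<in> carrier R; w \<in> carrier R\<rbrakk> \<Longrightarrow> r x v \<diamondop> w = v \<diamondop> l x w"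

definition left_mult :: "('a \<Rightarrow> 'a \<Rightarrow> 'a) \<Rightarrow> 'a \<Rightarrow> 'a \<Rightarrow> 'a" where
  "left_mult f x = (\<lambda>y. f x y)"

definition right_mult :: "('a \<Rightarrow> 'a \<Rightarrow> 'a) \<Rightarrow> 'a \<Rightarrow> 'a \<Rightarrow> 'a" where
  "right_mult f x = (\<lambda>y. f y x)"

end

theory Submission
  imports Defs
begin

text \<open>
  For the regular actions of \<open>(A, \<ast>)\<close> on \<open>(A, \<diamondop>)\<close>, linearity of the two actions is bilinearity of
  \<open>\<ast>\<close>, and the three laws that mention \<open>\<ast>\<close> only are associativity of \<open>\<ast>\<close>. The other three laws
  read

    \<open>x \<ast> (v \<diamondop> w) = (x \<ast> v) \<diamondop> w\<close>,
    \<open>(v \<diamondop> w) \<ast> x = v \<diamondop> (w \<ast> x)\<close>,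
    \<open>(v \<ast> x) \<diamondop> w = v \<diamondop> (x \<ast> w)\<close>.

  Up to renaming, each is an equality between two of the four products
  \<open>(a \<ast> b) \<diamondop> c\<close>, \<open>a \<ast> (b \<diamondop> c)\<close>, \<open>(a \<diamondop> b) \<ast> c\<close>, \<open>a \<diamondop> (b \<ast> c)\<close>. The three equalities form a path
  through all four products, so they hold together exactly when all four products agree,
  which is total compatibility.
\<close>

lemma bilinear_op_linear_left_mult:
  assumes "bilinear_op K A f"
  shows "linear_to_End K A A (left_mult f)"
  using assms by (simp add: linear_to_End_def bilinear_op_def left_mult_def module_hom_def)

lemma bilinear_op_linear_right_mult:
  assumes "bilinear_op K A f"
  shows "linear_to_End K A A (right_mult f)"
  using assms by (simp add: linear_to_End_def bilinear_op_def right_mult_def module_hom_def)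

lemma (in totally_compatible_dialgebra) regular_bimodule_algebra:
  "bimodule_algebra K A ast A odot (left_mult ast) (right_mult ast)"
proof unfold_locales
  show "linear_to_End K A A (left_mult ast)"
    using ast.bilinear by (rule bilinear_op_linear_left_mult)
  show "linear_to_End K A A (right_mult ast)"
    using ast.bilinear by (rule bilinear_op_linear_right_mult)
qed (simp_all add: left_mult_def right_mult_def ast.assoc compat1 compat2 compat3)

lemma regular_bimodule_algebra_imp_totally_compatible:
  assumes "bimodule_algebra K A ast A odot (left_mult ast) (right_mult ast)"
  shows "totally_compatible_dialgebra K A ast odot"
proof -
  interpret bimodule_algebra K A ast A odot "left_mult ast" "right_mult ast"
    by (fact assms)
  have left: "ast x (odot v w) = odot (ast x v) w"
    and right: "ast (odot v w) x = odot v (ast w x)"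
    and balanced: "odot (ast v x) w = odot v (ast x w)"
    if "x \<in> carrier A" "v \<in> carrier A" "w \<in> carrier A" for x v w
    using l_circ[OF that] r_circ[OF that] r_circ_l[OF that]
    by (simp_all add: left_mult_def right_mult_def)
  show ?thesis
    by unfold_locales (simp_all add: left right balanced)
qed

theorem proposition2p4:
  fixes K :: "('k, 'c) ring_scheme"
    and A :: "('k, 'a, 'd) module_scheme"
    and ast odot :: "'a \<Rightarrow> 'a \<Rightarrow> 'a"
  shows "(totally_compatible_dialgebra K A ast odot \<longrightarrow>
            bimodule_algebra K A ast A odot (left_mult ast) (right_mult ast)) \<and>
         (assoc_algebra K A ast \<and>
          bimodule_algebra K A ast A odot (left_mult ast) (right_mult ast) \<longrightarrow>
            totally_compatible_dialgebra K A ast odot)"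
  by (blast intro: totally_compatible_dialgebra.regular_bimodule_algebra
      regular_bimodule_algebra_imp_totally_compatible)

end
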